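(* Let $A_1A_2A_3A_4$ be a fundamental tetrahedron with vertices in $\widehat{\mathbb Q}(\sigma)$, choose any $X\in \widehat{\mathbb Q}(\sigma)$ distinct from $A_i$. Let $\lambda_i=\lambda_{XA_i}$ be the $\lambda$-length of $XA_i$, $i=1,\dots,4$. Then $$\sum_{i=1}^4 \lambda_i^4=\sum_{1\le i<j\le 4} \lambda_i^2\lambda_j^2.$$
   Context: Let $\sigma=e^{i\pi/3}=\frac{1+i\sqrt3}{2}$, ${\mathbb Z}[\sigma]$ the Eisenstein integers, ${\mathbb Q}(\sigma)$ its field of fractions and $\widehat{\mathbb Q}(\sigma)={\mathbb Q}(\sigma)\cup\{\infty\}$, viewed as points of the boundary $\widehat{\mathbb C}$ of the upper half-space model of ${\mathbb H}^3$. Let $T$ be the regular ideal tetrahedron with vertices $0,1,\sigma,\infty$, and $H$ the group generated by reflections in the faces of $T$; the images $hT$, $h\in H$, are called fundamental tetrahedra; they tile ${\mathbb H}^3$ and their vertex set is $\widehat{\mathbb Q}(\sigma)$. For two points $A,B\in\partial{\mathbb H}^3$ with chosen horospheres $h_A,h_B$ centred at them, the $\lambda$-length is $\lambda_{AB}=\exp(d/2)$, where $d$ is the signed distance between $h_A$ and $h_B$ (negative if the horoballs intersect). Horospheres are assumed chosen at every point of $\widehat{\mathbb Q}(\sigma)$; by default the standard choice: at the vertices of $T$ take the four pairwise tangent horospheres (three Euclidean balls of radius $1/2$ tangent to ${\mathbb C}$ at $0,1,\sigma$ and the horizontal plane at height $1$ at $\infty$), and transport them to all of $\widehat{\mathbb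 Q}(\sigma)$ by the action of $PGL_2({\mathbb Z}[\sigma])$, so that the four horospheres at the vertices of every fundamental tetrahedron are mutually tangent. (The relation is homogeneous, so the choice of horospheres does not affect its validity.) *)

theory Defs
  imports "HOL-Analysis.Analysis" "HOL-Algebra.Bij" "HOL-Algebra.Generated_Groups"
begin

definition \<sigma> :: complex where
  "\<sigma> = exp (\<i> * complex_of_real (pi / 3))"

definition eisenstein_integers :: "complex set" where
  "eisenstein_integers = {of_int m + of_int n * \<sigma> | m n. True}"

definition eisenstein_field :: "complex set" where
  "eisenstein_field = {a / b | a b. a \<in> eisenstein_integers \<and> b \<in> eisenstein_integers \<and> b \<noteq> 0}"

text \<open>
  Upper half-space model. \<open>Some (z, t)\<close> with \<open>t > 0\<close> is a point of hyperbolic 3-space, and the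
  boundary consists of the points \<open>Some (z, 0)\<close> together with \<open>None\<close>, the point at infinity.
  The points with \<open>t < 0\<close> are only there so that reflections (inversions of the whole
  one-point compactification) are bijections of the type.
\<close>

type_synonym point = "(complex \<times> real) option"

definition extended_eisenstein_field :: "point set" where
  "extended_eisenstein_field = insert None ((\<lambda>z. Some (z, 0)) ` eisenstein_field)"

text \<open>Hyperbolic distance between points of the open upper half-space.\<close>

definition hyp_dist :: "complex \<times> real \<Rightarrow> complex \<times> real \<Rightarrow> real" where
  "hyp_dist p q = arcosh (1 + (dist p q)\<^sup>2 / (2 * snd p * snd q))"

fun geodesic :: "point \<Rightarrow> point \<Rightarrow> (complex \<times> real) set" where
  "geodesic (Some (a, _)) (Some (b, _)) =
     {(z, t). t > 0 \<and> z \<in> closed_segment a b \<and> dist (z, t) (midpoint a b, 0) = dist a b / 2}"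
| "geodesic (Some (a, _)) None = {(z, t). t > 0 \<and> z = a}"
| "geodesic None (Some (b, _)) = {(z, t). t > 0 \<and> z = b}"
| "geodesic None None = {}"

text \<open>
  A horosphere is given by its centre (a boundary point) and its size \<open>s > 0\<close>: the Euclidean
  diameter if the centre is finite, the Euclidean height if the centre is infinity.
\<close>

fun horosphere :: "point \<Rightarrow> real \<Rightarrow> (complex \<times> real) set" where
  "horosphere None s = {(z, t). t = s}"
| "horosphere (Some (a, _)) s = sphere (a, s / 2) (s / 2) - {(a, 0)}"

fun horoball :: "point \<Rightarrow> real \<Rightarrow> (complex \<times> real) set" where
  "horoball None s = {(z, t). t > s}"
| "horoball (Some (a, _)) s = ball (a, s / 2) (s / 2)"

text \<open>
  The signed distance is measured along the geodesic joining the two centres; tangent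
  horospheres have disjoint open horoballs and distance 0.
\<close>

definition signed_distance :: "point \<Rightarrow> real \<Rightarrow> point \<Rightarrow> real \<Rightarrow> real" where
  "signed_distance P s Q r =
     (let p = (THE p. p \<in> geodesic P Q \<inter> horosphere P s);
          q = (THE q. q \<in> geodesic P Q \<inter> horosphere Q r)
      in if horoball P s \<inter> horoball Q r = {} then hyp_dist p q else - hyp_dist p q)"

text \<open>
  \<open>lambda_length hs P Q\<close> is the lambda-length of \<open>PQ\<close> for the choice of horospheres
  \<open>horosphere R (hs R)\<close>.
\<close>

definition lambda_length :: "(point \<Rightarrow> real) \<Rightarrow> point \<Rightarrow> point \<Rightarrow> real" where
  "lambda_length hs P Q = exp (signed_distance P (hs P) Q (hs Q) / 2)"

text \<open>Ideal tetrahedra are represented by their sets of (ideal) vertices.\<close>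

definition base_tetrahedron :: "point set" where
  "base_tetrahedron = {Some (0, 0), Some (1, 0), Some (\<sigma>, 0), None}"

text \<open>Reflection in the vertical plane over the line through \<open>p\<close> and \<open>q\<close>.\<close>

fun vertical_reflection :: "complex \<Rightarrow> complex \<Rightarrow> point \<Rightarrow> point" where
  "vertical_reflection p q None = None"
| "vertical_reflection p q (Some (z, t)) = Some (p + (q - p) * cnj ((z - p) / (q - p)), t)"

text \<open>Reflection in the hemisphere of centre \<open>c\<close> and radius \<open>r\<close>.\<close>

fun hemisphere_reflection :: "complex \<Rightarrow> real \<Rightarrow> point \<Rightarrow> point" where
  "hemisphere_reflection c r None = Some (c, 0)"
| "hemisphere_reflection c r (Some x) =
     (if x = (c, 0) then None
      else Some ((c, 0) + (r\<^sup>2 / (dist x (c, 0))\<^sup>2) *\<^sub>R (x - (c, 0))))"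

text \<open>
  The last face, with vertices \<open>0\<close>, \<open>1\<close>, \<open>\<sigma>\<close>, lies on the hemisphere over the circumcircle of
  this equilateral triangle.
\<close>

definition face_reflections :: "(point \<Rightarrow> point) set" where
  "face_reflections =
     {vertical_reflection 0 1, vertical_reflection 0 \<sigma>, vertical_reflection 1 \<sigma>,
      hemisphere_reflection ((1 + \<sigma>) / 3) (1 / sqrt 3)}"

text \<open>The generators are elements of the group of all permutations of the type.\<close>

lemma sigma_eq: "\<sigma> = Complex (1/2) (sqrt 3 / 2)"
  by (simp add: \<sigma>_def exp_eq_polar cos_60 sin_60 complex_eq_iff cis.code Re_exp Im_exp)

lemma sigma_neq: "\<sigma> \<noteq> 0" "\<sigma> \<noteq> 1"
  by (auto simp: sigma_eq complex_eq_iff)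

lemma vert_invol: assumes "p \<noteq> q" shows "vertical_reflection p q (vertical_reflection p q x) = x"
proof (cases x)
  case (Some y) then show ?thesis using assms by (cases y) simp
qed simp

lemma hemi_invol: assumes "r > 0" shows "hemisphere_reflection c r (hemisphere_reflection c r x) = x"
proof (cases x)
  case (Some y)
  show ?thesis
  proof (cases "y = (c, 0)")
    case False
    define v where "v = y - (c,0)"
    have v: "v \<noteq> 0" "y = (c,0) + v" using False by (auto simp: v_def)
    define k where "k = r\<^sup>2 / (norm v)\<^sup>2"
    have k: "k > 0" using v assms by (simp add: k_def)
    have 1: "hemisphere_reflection c r x = Some ((c,0) + k *\<^sub>R v)"
      using False Some by (simp add: v_def k_def dist_norm)
    have "r\<^sup>2 / (norm (k *\<^sub>R v))\<^sup>2 * k = 1"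
      using v k assms by (simp add: k_def power_mult_distrib field_simps power2_eq_square)
    moreover have "(c,0) + k *\<^sub>R v \<noteq> (c,0)" using v k by (simp add: add_left_imp_eq)
    ultimately show ?thesis using k v Some assms unfolding 1 by (simp add: dist_norm)
  qed (simp add: Some)
qed simp

lemma face_reflections_bij: "face_reflections \<subseteq> carrier (BijGroup UNIV)"
proof -
  have *: "f \<in> carrier (BijGroup UNIV)" if "\<And>x. f (f x) = x" for f :: "point \<Rightarrow> point"
    using that by (auto simp: BijGroup_def Bij_def intro!: o_bij[of f f])
  show ?thesis unfolding face_reflections_def
    using sigma_neq vert_invol hemi_invol by (auto intro!: *)
qed

definition reflection_group :: "(point \<Rightarrow> point) set" where
  "reflection_group = generate (BijGroup UNIV) face_reflections"

definition fundamental_tetrahedra :: "point set set" where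
  "fundamental_tetrahedra = {h ` base_tetrahedron | h. h \<in> reflection_group}"

text \<open>
  Representatives of the elements of \<open>PGL\<^sub>2\<close> of the Eisenstein integers; scalar matrices
  act trivially below.
\<close>

definition GL2_eisenstein :: "(complex^2^2) set" where
  "GL2_eisenstein =
     {M. (\<forall>i j. M $ i $ j \<in> eisenstein_integers) \<and> (\<exists>u\<in>eisenstein_integers. det M * u = 1)}"

text \<open>
  The Poincare extension of the Moebius transformation \<open>z \<mapsto> (a z + b) / (c z + d)\<close>, which for
  \<open>t = 0\<close> is the Moebius transformation itself.
\<close>

fun moebius_action :: "complex^2^2 \<Rightarrow> point \<Rightarrow> point" where
  "moebius_action M None =
     (if M $ 2 $ 1 = 0 then None else Some (M $ 1 $ 1 / M $ 2 $ 1, 0))"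
| "moebius_action M (Some (z, t)) =
     (let a = M $ 1 $ 1; b = M $ 1 $ 2; c = M $ 2 $ 1; d = M $ 2 $ 2;
          n = (cmod (c * z + d))\<^sup>2 + (cmod c)\<^sup>2 * t\<^sup>2
      in if n = 0 then None
         else Some (((a * z + b) * cnj (c * z + d) + a * cnj c * of_real (t\<^sup>2)) / of_real n,
                    cmod (det M) * t / n))"

text \<open>
  The four pairwise tangent horospheres at the vertices of the base tetrahedron all have
  size 1; the standard horospheres are their images.
\<close>

definition standard_horosphere :: "point \<Rightarrow> real \<Rightarrow> bool" where
  "standard_horosphere P s \<longleftrightarrow> s > 0 \<and>
     (\<exists>M\<in>GL2_eisenstein. \<exists>V\<in>base_tetrahedron.
        moebius_action M V = P \<and>
        moebius_action M ` Some ` horosphere V 1 = Some ` horosphere P s)"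

end

theory Submission
  imports Defs
begin

text \<open>
  Write a boundary point as a primitive vector \<open>v = (p, q)\<close> over the Eisenstein integers. The face
  reflections act on such vectors by semilinear maps of unimodular determinant, so the vertices of
  a fundamental tetrahedron have representatives \<open>v\<^sub>i\<close> whose pairwise determinants have modulus 1.
  The standard horosphere at \<open>p / q\<close> has Euclidean diameter \<open>1 / |q|\<^sup>2\<close>, so that
  \<open>\<lambda>\<^sub>i\<^sup>2\<close> is proportional to \<open>|det (x, v\<^sub>i)|\<^sup>2\<close> for any vector \<open>x\<close> representing \<open>X\<close>. The Pluecker
  relations express \<open>det (x, v\<^sub>3)\<close> and \<open>det (x, v\<^sub>4)\<close> through \<open>det (x, v\<^sub>1)\<close> and \<open>det (x, v\<^sub>2)\<close>, with
  a cross ratio \<open>\<omega>\<close> satisfying \<open>|\<omega>| = |1 - \<omega>| = 1\<close>.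
\<close>

section \<open>Eisenstein integers\<close>

lemma sigma_square: "\<sigma> * \<sigma> = \<sigma> - 1"
  by (simp add: sigma_eq complex_eq_iff)

lemma cnj_sigma: "cnj \<sigma> = 1 - \<sigma>"
  by (simp add: sigma_eq complex_eq_iff)

lemma cmod_sigma: "cmod \<sigma> = 1"
  by (simp add: \<sigma>_def)

lemma eisenstein_add:
  assumes "a \<in> eisenstein_integers" "b \<in> eisenstein_integers"
  shows "a + b \<in> eisenstein_integers"
proof -
  obtain m n k l where "a = of_int m + of_int n * \<sigma>" "b = of_int k + of_int l * \<sigma>"
    using assms by (auto simp: eisenstein_integers_def)
  then have "a + b = of_int (m + k) + of_int (n + l) * \<sigma>" by (simp add: algebra_simps)
  then show ?thesis unfolding eisenstein_integers_def by blast
qed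

lemma eisenstein_mult:
  assumes "a \<in> eisenstein_integers" "b \<in> eisenstein_integers"
  shows "a * b \<in> eisenstein_integers"
proof -
  obtain m n k l where ab: "a = of_int m + of_int n * \<sigma>" "b = of_int k + of_int l * \<sigma>"
    using assms by (auto simp: eisenstein_integers_def)
  have "a * b = of_int m * of_int k + (of_int m * of_int l + of_int n * of_int k) * \<sigma>
      + of_int n * of_int l * (\<sigma> * \<sigma>)"
    by (simp add: ab algebra_simps)
  then have "a * b = of_int (m * k - n * l) + of_int (m * l + n * k + n * l) * \<sigma>"
    unfolding sigma_square by (simp add: algebra_simps)
  then show ?thesis unfolding eisenstein_integers_def by blast
qed

lemma eisenstein_of_int: "of_int m \<in> eisenstein_integers"
  unfolding eisenstein_integers_def by (rule CollectI, rule exI[of _ m], rule exI[of _ 0]) simp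

lemma eisenstein_0: "0 \<in> eisenstein_integers"
  using eisenstein_of_int[of 0] by simp

lemma eisenstein_1: "1 \<in> eisenstein_integers"
  using eisenstein_of_int[of 1] by simp

lemma eisenstein_2: "2 \<in> eisenstein_integers"
  using eisenstein_of_int[of 2] by simp

lemma eisenstein_sigma: "\<sigma> \<in> eisenstein_integers"
  unfolding eisenstein_integers_def by (rule CollectI, rule exI[of _ 0], rule exI[of _ 1]) simp

lemma eisenstein_uminus: "a \<in> eisenstein_integers \<Longrightarrow> - a \<in> eisenstein_integers"
  using eisenstein_mult[OF eisenstein_of_int[of "-1"]] by simp

lemma eisenstein_diff:
  "a \<in> eisenstein_integers \<Longrightarrow> b \<in> eisenstein_integers \<Longrightarrow> a - b \<in> eisenstein_integers"
  using eisenstein_add[OF _ eisenstein_uminus] by fastforce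

lemma eisenstein_cnj:
  assumes "a \<in> eisenstein_integers"
  shows "cnj a \<in> eisenstein_integers"
proof -
  obtain m n where "a = of_int m + of_int n * \<sigma>"
    using assms by (auto simp: eisenstein_integers_def)
  then have "cnj a = of_int m + of_int n * (1 - \<sigma>)" by (simp add: cnj_sigma)
  then show ?thesis
    by (simp add: eisenstein_add eisenstein_mult eisenstein_diff eisenstein_of_int
        eisenstein_1 eisenstein_sigma)
qed

lemmas eisenstein_closed = eisenstein_0 eisenstein_1 eisenstein_2 eisenstein_sigma
  eisenstein_add eisenstein_diff eisenstein_uminus eisenstein_mult eisenstein_cnj

text \<open>The squared modulus is the norm form m^2 + m n + n^2, an integer, so it cannot lie
  strictly between 0 and 1.\<close>

lemma eisenstein_cmod_ge_1:
  assumes "a \<in> eisenstein_integers" "a \<noteq> 0"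
  shows "cmod a \<ge> 1"
proof -
  obtain m n where a: "a = of_int m + of_int n * \<sigma>"
    using assms by (auto simp: eisenstein_integers_def)
  have "(cmod a)\<^sup>2 = (real_of_int m + real_of_int n / 2)\<^sup>2 + (real_of_int n * (sqrt 3 / 2))\<^sup>2"
    by (simp add: a cmod_power2 sigma_eq)
  also have "\<dots> = of_int (m * m + m * n + n * n)"
    by (simp add: power2_eq_square algebra_simps)
  finally have norm: "(cmod a)\<^sup>2 = of_int (m * m + m * n + n * n)" .
  have "0 < (cmod a)\<^sup>2" using assms by simp
  then have "1 \<le> m * m + m * n + n * n" unfolding norm of_int_0_less_iff by simp
  then have "1\<^sup>2 \<le> (cmod a)\<^sup>2" unfolding norm one_power2 of_int_1_le_iff .
  then show ?thesis by (rule power2_le_imp_le) simp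
qed

section \<open>Homogeneous coordinates\<close>

definition det2 :: "complex \<times> complex \<Rightarrow> complex \<times> complex \<Rightarrow> complex" where
  "det2 v w = fst v * snd w - snd v * fst w"

text \<open>The zero vector also lands on infinity, which is why later statements restrict to
  nonzero vectors.\<close>

definition vpoint :: "complex \<times> complex \<Rightarrow> point" where
  "vpoint v = (if snd v = 0 then None else Some (fst v / snd v, 0))"

definition lin :: "complex \<Rightarrow> complex \<Rightarrow> complex \<Rightarrow> complex \<Rightarrow> complex \<times> complex \<Rightarrow> complex \<times> complex"
  where "lin a b c d v = (a * fst v + b * snd v, c * fst v + d * snd v)"

definition conj2 :: "complex \<times> complex \<Rightarrow> complex \<times> complex" where
  "conj2 v = (cnj (fst v), cnj (snd v))"

lemma det2_lin: "det2 (lin a b c d v) (lin a b c d w) = (a * d - b * c) * det2 v w"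
  by (simp add: det2_def lin_def algebra_simps)

lemma cmod_det2_conj2: "cmod (det2 (conj2 v) (conj2 w)) = cmod (det2 v w)"
proof -
  have "det2 (conj2 v) (conj2 w) = cnj (det2 v w)"
    by (simp add: det2_def conj2_def)
  then show ?thesis by simp
qed

lemma vpoint_eq_imp_det2_0:
  assumes "vpoint v = vpoint w"
  shows "det2 v w = 0"
  using assms by (auto simp: vpoint_def det2_def field_simps split: if_splits)

abbreviation eisenstein_vectors :: "(complex \<times> complex) set" where
  "eisenstein_vectors \<equiv> eisenstein_integers \<times> eisenstein_integers"

text \<open>Coprimality of the coordinates without gcds: an Eisenstein integer of modulus 1 is a
  unit, so \<open>v\<close> and \<open>w\<close> form a basis of the rank-two Eisenstein
  lattice.\<close>

definition primitive :: "complex \<times> complex \<Rightarrow> bool" where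
  "primitive v \<longleftrightarrow> v \<in> eisenstein_vectors \<and> (\<exists>w \<in> eisenstein_vectors. cmod (det2 v w) = 1)"

lemma primitive_nonzero: "primitive v \<Longrightarrow> fst v \<noteq> 0 \<or> snd v \<noteq> 0"
  by (auto simp: primitive_def det2_def)

lemma det2_eisenstein:
  "v \<in> eisenstein_vectors \<Longrightarrow> w \<in> eisenstein_vectors \<Longrightarrow> det2 v w \<in> eisenstein_integers"
  by (auto simp: det2_def eisenstein_closed)

text \<open>Pairing \<open>w\<close> with the complement \<open>u\<close> of \<open>v\<close> gives
  a nonzero Eisenstein integer whose modulus is that of \<open>k\<close>.\<close>

lemma primitive_multiple_ge_1:
  assumes v: "primitive v" and w: "w \<in> eisenstein_vectors"
    and eq: "fst w = k * fst v" "snd w = k * snd v" and k: "k \<noteq> 0"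
  shows "cmod k \<ge> 1"
proof -
  obtain u where u: "u \<in> eisenstein_vectors" "cmod (det2 v u) = 1"
    using v by (auto simp: primitive_def)
  have det: "det2 w u = k * det2 v u" by (simp add: det2_def eq algebra_simps)
  have "det2 w u \<noteq> 0" using u k by (auto simp: det)
  then have "cmod (det2 w u) \<ge> 1" by (intro eisenstein_cmod_ge_1 det2_eisenstein w u)
  then show ?thesis by (simp add: det norm_mult u)
qed

text \<open>Two representatives of a point are proportional. The previous bound, applied to the
  factor and to its inverse, gives the factor modulus 1.\<close>

lemma primitive_unique:
  assumes v: "primitive v" and w: "primitive w" and eq: "vpoint v = vpoint w"
  shows "cmod (fst v) = cmod (fst w)" "cmod (snd v) = cmod (snd w)"
proof -
  have "\<exists>k. k \<noteq> 0 \<and> fst w = k * fst v \<and> snd w = k * snd v"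
  proof (cases "snd v = 0")
    case True
    then have "snd w = 0" "fst v \<noteq> 0" "fst w \<noteq> 0"
      using eq primitive_nonzero[OF v] primitive_nonzero[OF w]
      by (auto simp: vpoint_def split: if_splits)
    with True show ?thesis by (intro exI[of _ "fst w / fst v"]) auto
  next
    case False
    then have "snd w \<noteq> 0" "fst v / snd v = fst w / snd w"
      using eq by (auto simp: vpoint_def split: if_splits)
    with False show ?thesis by (intro exI[of _ "snd w / snd v"]) (auto simp: field_simps)
  qed
  then obtain k where k: "k \<noteq> 0" "fst w = k * fst v" "snd w = k * snd v" by blast
  have "cmod k \<ge> 1"
    using primitive_multiple_ge_1[OF v _ k(2,3,1)] w by (simp add: primitive_def)
  moreover have "cmod (1 / k) \<ge> 1"
    by (rule primitive_multiple_ge_1[OF w]) (use v k in \<open>auto simp: primitive_def\<close>)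
  ultimately have "cmod k = 1"
    by (smt (verit) k(1) le_divide_eq_1_pos norm_divide norm_one zero_less_norm_iff)
  then show "cmod (fst v) = cmod (fst w)" "cmod (snd v) = cmod (snd w)"
    by (simp_all add: k norm_mult)
qed

section \<open>Fundamental tetrahedra\<close>

text \<open>The invariant carried along the reflection group. A tetrahedron is only a set of points,
  so the numbering of the vectors is existential.\<close>

definition unimodular_tetrahedron :: "point set \<Rightarrow> bool" where
  "unimodular_tetrahedron S \<longleftrightarrow> (\<exists>v :: nat \<Rightarrow> complex \<times> complex.
     S = (\<lambda>i. vpoint (v i)) ` {1..4} \<and> v ` {1..4} \<subseteq> eisenstein_vectors \<and>
     (\<forall>i\<in>{1..4}. \<forall>j\<in>{1..4}. i \<noteq> j \<longrightarrow> cmod (det2 (v i) (v j)) = 1))"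

lemma atLeastAtMost_1_4: "{1..4::nat} = {1, 2, 3, 4}"
  by auto

lemma base_unimodular: "unimodular_tetrahedron base_tetrahedron"
proof -
  define v :: "nat \<Rightarrow> complex \<times> complex" where
    "v i = (if i = 1 then (0, 1) else if i = 2 then (1, 1) else if i = 3 then (\<sigma>, 1) else (1, 0))"
    for i
  have "cmod (1 - \<sigma>) = 1" using cmod_sigma cnj_sigma by (metis complex_mod_cnj)
  then have "\<forall>i\<in>{1..4}. \<forall>j\<in>{1..4}. i \<noteq> j \<longrightarrow> cmod (det2 (v i) (v j)) = 1"
    by (auto simp: atLeastAtMost_1_4 v_def det2_def cmod_sigma norm_minus_commute)
  moreover have "base_tetrahedron = (\<lambda>i. vpoint (v i)) ` {1..4}"
    unfolding atLeastAtMost_1_4 by (simp add: v_def vpoint_def base_tetrahedron_def)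
  moreover have "v ` {1..4} \<subseteq> eisenstein_vectors"
    by (auto simp: v_def eisenstein_closed)
  ultimately show ?thesis unfolding unimodular_tetrahedron_def by blast
qed

text \<open>Reflections reverse orientation, so on the boundary they are Moebius maps preceded by
  complex conjugation. Conjugation keeps the modulus of a determinant, and the linear part
  multiplies it by 1.\<close>

lemma semilinear_unimodular:
  assumes S: "unimodular_tetrahedron S"
    and coeffs: "{a, b, c, d} \<subseteq> eisenstein_integers" and det: "cmod (a * d - b * c) = 1"
    and g: "\<And>v. fst v \<noteq> 0 \<or> snd v \<noteq> 0 \<Longrightarrow> g (vpoint v) = vpoint (lin a b c d (conj2 v))"
  shows "unimodular_tetrahedron (g ` S)"
proof -
  obtain v :: "nat \<Rightarrow> complex \<times> complex" where S_eq: "S = (\<lambda>i. vpoint (v i)) ` {1..4}"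
    and v: "v ` {1..4} \<subseteq> eisenstein_vectors"
    and dets: "\<And>i j. i \<in> {1..4} \<Longrightarrow> j \<in> {1..4} \<Longrightarrow> i \<noteq> j \<Longrightarrow> cmod (det2 (v i) (v j)) = 1"
    using S unfolding unimodular_tetrahedron_def by blast
  \<comment> \<open>A vector with a determinant of modulus 1 against another one cannot
    vanish.\<close>
  have nonzero: "fst (v i) \<noteq> 0 \<or> snd (v i) \<noteq> 0" if "i \<in> {1..4}" for i
  proof -
    obtain j where "j \<in> {1..4::nat}" "i \<noteq> j"
      by (rule that[of "if i = 1 then 2 else 1"]) auto
    then show ?thesis using dets[OF that] by (force simp: det2_def)
  qed
  define w where "w i = lin a b c d (conj2 (v i))" for i
  have "g ` S = (\<lambda>i. vpoint (w i)) ` {1..4}"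
    unfolding S_eq image_image w_def by (intro image_cong refl g nonzero)
  moreover have "w ` {1..4} \<subseteq> eisenstein_vectors"
  proof (rule image_subsetI)
    fix i :: nat assume "i \<in> {1..4}"
    then have "v i \<in> eisenstein_vectors" using v by blast
    then show "w i \<in> eisenstein_vectors"
      using coeffs by (cases "v i") (auto simp: w_def lin_def conj2_def intro!: eisenstein_closed)
  qed
  moreover have "\<forall>i\<in>{1..4}. \<forall>j\<in>{1..4}. i \<noteq> j \<longrightarrow> cmod (det2 (w i) (w j)) = 1"
    by (auto simp: w_def det2_lin norm_mult det cmod_det2_conj2 dets)
  ultimately show ?thesis unfolding unimodular_tetrahedron_def by blast
qed

section \<open>Matrices of the four face reflections\<close>

lemma vertical_reflection_finite:
  assumes "z = p + (q - p) / cnj (q - p) * (cnj x - cnj p)"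
  shows "vertical_reflection p q (Some (x, 0)) = Some (z, 0)"
  using assms by simp

text \<open>Restricted to the boundary this is inversion in a circle: w / |w|^2 = 1 / cnj w for w =
  x - c.\<close>

lemma hemisphere_reflection_finite:
  assumes "x \<noteq> c"
  shows "hemisphere_reflection c r (Some (x, 0)) = Some (c + of_real (r\<^sup>2) / cnj (x - c), 0)"
proof -
  have "(dist (x, 0) (c, 0::real))\<^sup>2 = (cmod (x - c))\<^sup>2"
    by (simp add: dist_Pair_Pair dist_norm)
  moreover have "(r\<^sup>2 / (cmod (x - c))\<^sup>2) *\<^sub>R (x - c) = of_real (r\<^sup>2) / cnj (x - c)"
    using assms
    by (simp add: scaleR_conv_of_real complex_norm_square field_simps del: of_real_power complex_cnj_diff)
  ultimately show ?thesis using assms by simp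
qed

lemma face_reflection_unimodular:
  assumes "g \<in> face_reflections" and S: "unimodular_tetrahedron S"
  shows "unimodular_tetrahedron (g ` S)"
proof -
  note semilinear = semilinear_unimodular[OF S]
  consider "g = vertical_reflection 0 1" | "g = vertical_reflection 0 \<sigma>"
    | "g = vertical_reflection 1 \<sigma>" | "g = hemisphere_reflection ((1 + \<sigma>) / 3) (1 / sqrt 3)"
    using assms(1) by (auto simp: face_reflections_def)
  then show ?thesis
  proof cases
    case 1
    \<comment> \<open>Reflection in the real axis is plain conjugation, so the matrix is the
      identity.\<close>
    show ?thesis
      by (rule semilinear[of 1 0 0 1])
         (auto simp: 1 vpoint_def lin_def conj2_def eisenstein_closed)
  next
    case 2
    \<comment> \<open>Reflection in the line through 0 and \<sigma> is conjugation followed by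
      multiplication with this factor, which is \<sigma>^2.\<close>
    have *: "\<sigma> / cnj \<sigma> = \<sigma> - 1"
      unfolding cnj_sigma using sigma_square sigma_neq by (simp add: field_simps)
    have "g (vpoint v) = vpoint (lin (\<sigma> - 1) 0 0 1 (conj2 v))" for v
    proof (cases "snd v = 0")
      case False
      then show ?thesis
        unfolding 2 vpoint_def lin_def conj2_def
        by (simp del: vertical_reflection.simps, intro vertical_reflection_finite) (simp add: *)
    qed (simp add: 2 vpoint_def lin_def conj2_def)
    moreover have "cmod (\<sigma> - 1) = 1"
      using cmod_sigma cnj_sigma by (metis complex_mod_cnj norm_minus_commute)
    ultimately show ?thesis
      by (intro semilinear[of "\<sigma> - 1" 0 0 1]) (auto simp: eisenstein_closed)
  next
    case 3
    have "cnj (\<sigma> - 1) = - \<sigma>" by (simp add: cnj_sigma)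
    \<comment> \<open>This is the linear coefficient; the translation part 1 + \<sigma> below is
      what keeps the point 1 fixed.\<close>
    then have *: "(\<sigma> - 1) / cnj (\<sigma> - 1) = - \<sigma>"
      unfolding sigma_square[symmetric] using sigma_neq by simp
    have "g (vpoint v) = vpoint (lin (- \<sigma>) (1 + \<sigma>) 0 1 (conj2 v))" for v
    proof (cases "snd v = 0")
      case False
      then show ?thesis
        unfolding 3 vpoint_def lin_def conj2_def
        by (simp del: vertical_reflection.simps, intro vertical_reflection_finite)
           (simp add: * field_simps del: complex_cnj_diff)
    qed (simp add: 3 vpoint_def lin_def conj2_def)
    then show ?thesis
      by (intro semilinear[of "- \<sigma>" "1 + \<sigma>" 0 1]) (auto simp: eisenstein_closed cmod_sigma)
  next
    case 4
    let ?c = "(1 + \<sigma>) / 3"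
    have s3: "(2 - \<sigma>) * (1 + \<sigma>) = 3" using sigma_square by (simp add: algebra_simps)
    have s3': "cnj ?c = (2 - \<sigma>) / 3" by (simp add: cnj_sigma)
    have nz: "1 + \<sigma> \<noteq> 0" "2 - \<sigma> \<noteq> 0" using s3 by auto
    \<comment> \<open>With Z = cnj z the inversion is (1 + \<sigma>) Z / (3 Z - (2 - \<sigma>)).
      Cancelling 1 + \<sigma>, of norm 3, by means of \<open>s3\<close> leaves this matrix, whose
      determinant \<sigma> - 1 has modulus 1.\<close>
    have img: "g (vpoint v) = vpoint (lin 1 0 (2 - \<sigma>) (\<sigma> - 1) (conj2 v))"
      if "fst v \<noteq> 0 \<or> snd v \<noteq> 0" for v
    proof -
      obtain p q where v: "v = (p, q)" by (cases v)
      define P Q where "P = cnj p" and "Q = cnj q"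
      \<comment> \<open>Infinity goes to the centre, the centre to infinity, and all other points
        follow the inversion formula.\<close>
      consider "q = 0" | "q \<noteq> 0" "p / q = ?c" | "q \<noteq> 0" "p / q \<noteq> ?c" by blast
      then show ?thesis
      proof cases
        case 1
        moreover have "cnj p / ((2 - \<sigma>) * cnj p) = ?c"
          using s3 nz that \<open>q = 0\<close> by (simp add: v divide_simps mult.commute)
        ultimately show ?thesis using nz that
          by (simp add: 4 v vpoint_def lin_def conj2_def)
      next
        case 2
        then have "p = q * ?c" by (simp add: field_simps)
        then have P: "P = Q * ((2 - \<sigma>) / 3)" unfolding P_def Q_def by (simp only: complex_cnj_mult s3')
        have "(2 - \<sigma>) * P + (\<sigma> - 1) * Q = 0"
          unfolding P using sigma_square by algebra
        then show ?thesis using 2 unfolding 4 v P_def Q_def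
          by (simp add: vpoint_def lin_def conj2_def)
      next
        case 3
        have Q: "Q \<noteq> 0" using 3 by (simp add: Q_def)
        have c: "cnj (p / q - ?c) = P / Q - (2 - \<sigma>) / 3"
          unfolding P_def Q_def s3'[symmetric] by simp
        have nz2: "P / Q - (2 - \<sigma>) / 3 \<noteq> 0"
          using 3 unfolding c[symmetric] complex_cnj_zero_iff right_minus_eq by blast
        have "(2 - \<sigma>) * Q * (P / Q - (2 - \<sigma>) / 3) = (2 - \<sigma>) * P - (2 - \<sigma>) * (2 - \<sigma>) / 3 * Q"
          using Q by (simp add: algebra_simps)
        \<comment> \<open>The denominator is a nonzero multiple of the conjugated difference from
          the centre, hence nonzero in this case.\<close>
        then have fac: "(2 - \<sigma>) * P + (\<sigma> - 1) * Q = (2 - \<sigma>) * Q * (P / Q - (2 - \<sigma>) / 3)"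
          using sigma_square by algebra
        have "?c + (1 / 3) / (P / Q - (2 - \<sigma>) / 3) = P / ((2 - \<sigma>) * P + (\<sigma> - 1) * Q)"
        proof -
          define D where "D = P / Q - (2 - \<sigma>) / 3"
          have P: "P = Q * (D + (2 - \<sigma>) / 3)" using Q by (simp add: D_def field_simps)
          have "D \<noteq> 0" using nz2 by (simp add: D_def)
          then show ?thesis unfolding fac D_def[symmetric] using Q nz s3
            unfolding P by (simp add: divide_simps) algebra
        qed
        moreover have "g (vpoint v) = Some (?c + (1 / 3) / (P / Q - (2 - \<sigma>) / 3), 0)"
          unfolding 4 vpoint_def v using 3 c
          by (simp add: hemisphere_reflection_finite power_divide del: hemisphere_reflection.simps
              complex_cnj_diff complex_cnj_divide)
        moreover have "vpoint (lin 1 0 (2 - \<sigma>) (\<sigma> - 1) (conj2 v))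
            = Some (P / ((2 - \<sigma>) * P + (\<sigma> - 1) * Q), 0)"
        proof -
          have "(2 - \<sigma>) * P + (\<sigma> - 1) * Q \<noteq> 0" unfolding fac using Q nz nz2 by simp
          then show ?thesis by (simp add: vpoint_def lin_def conj2_def v P_def Q_def)
        qed
        ultimately show ?thesis by simp
      qed
    qed
    have "cmod (\<sigma> - 1) = 1" using cmod_sigma cnj_sigma by (metis complex_mod_cnj norm_minus_commute)
    then show ?thesis
      by (intro semilinear[of 1 0 "2 - \<sigma>" "\<sigma> - 1"] img) (auto simp: eisenstein_closed)
  qed
qed

lemma fundamental_unimodular:
  assumes "S \<in> fundamental_tetrahedra"
  shows "unimodular_tetrahedron S"
proof -
  interpret G: group "BijGroup (UNIV :: point set)" by (rule group_BijGroup)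
  have mult: "(f \<otimes>\<^bsub>BijGroup UNIV\<^esub> g) ` T = f ` g ` T"
    if "f \<in> carrier (BijGroup UNIV)" "g \<in> carrier (BijGroup UNIV)"
    for f g :: "point \<Rightarrow> point" and T
    using that by (auto simp: BijGroup_def compose_def image_image)
  \<comment> \<open>The generators are involutions, so the inverse clause of \<open>generate\<close>
    reduces to the generators themselves.\<close>
  have inv: "inv\<^bsub>BijGroup UNIV\<^esub> g = g" if "g \<in> face_reflections" for g
  proof (rule G.inv_equality)
    have "g (g x) = x" for x
      using that sigma_neq vert_invol hemi_invol by (auto simp: face_reflections_def)
    then show "g \<otimes>\<^bsub>BijGroup UNIV\<^esub> g = \<one>\<^bsub>BijGroup UNIV\<^esub>"
      using that face_reflections_bij by (auto simp: BijGroup_def compose_def)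
  qed (use that face_reflections_bij in auto)
  have "unimodular_tetrahedron (h ` T)"
    if "h \<in> generate (BijGroup UNIV) face_reflections" "unimodular_tetrahedron T" for h T
    using that
  \<comment> \<open>\<open>T\<close> stays general because in a product the left factor acts on the
    image under the right one.\<close>
  proof (induction arbitrary: T rule: generate.induct)
    case one
    then show ?case by (simp add: BijGroup_def)
  next
    case (incl h)
    then show ?case by (intro face_reflection_unimodular)
  next
    case (inv h)
    then show ?case using \<open>\<And>g. g \<in> face_reflections \<Longrightarrow> inv\<^bsub>BijGroup UNIV\<^esub> g = g\<close>
      by (simp add: face_reflection_unimodular)
  next
    case (eng h1 h2)
    then show ?case
      using G.generate_in_carrier[OF face_reflections_bij] by (simp add: mult)
  qed
  then show ?thesis
    using assms base_unimodular by (auto simp: fundamental_tetrahedra_def reflection_group_def)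
qed

section \<open>Standard horospheres\<close>

text \<open>A primitive vector at infinity has first coordinate of modulus 1, hence size 1. Keeping
  the square there makes \<open>horofunction\<close> equal 1 at this height for every nonzero vector
  over infinity.\<close>

definition horosphere_size :: "complex \<times> complex \<Rightarrow> real" where
  "horosphere_size v = (if snd v = 0 then (cmod (fst v))\<^sup>2 else 1 / (cmod (snd v))\<^sup>2)"

lemma dist_Pair_square: "(dist (a, x) (b, y))\<^sup>2 = (cmod (a - b))\<^sup>2 + (x - (y :: real))\<^sup>2"
  by (simp add: dist_Pair_Pair dist_real_def) (simp add: dist_norm)

text \<open>
  The horosphere of size \<open>horosphere_size v\<close> at \<open>vpoint v\<close> is the level set of value 1 of this
  function, which is equivariant under linear maps up to the modulus of the determinant.
\<close>

definition horofunction :: "complex \<times> complex \<Rightarrow> complex \<Rightarrow> real \<Rightarrow> real" where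
  "horofunction v z t = ((cmod (fst v - snd v * z))\<^sup>2 + (cmod (snd v))\<^sup>2 * t\<^sup>2) / t"

text \<open>On a horosphere at a finite centre a, |a - z|^2 + t^2 = s t, so
  \<open>horofunction\<close> is constant there; at infinity it depends on the height alone. One
  point of value 1 therefore fixes the size.\<close>

lemma horofunction_size:
  assumes mem: "(z, t) \<in> horosphere (vpoint v) s" and "t > 0" and "fst v \<noteq> 0 \<or> snd v \<noteq> 0"
    and h: "horofunction v z t = 1"
  shows "s = horosphere_size v"
proof (cases "snd v = 0")
  case True
  with assms show ?thesis by (simp add: vpoint_def horosphere_size_def horofunction_def)
next
  case False
  define a where "a = fst v / snd v"
  have "dist (a, s / 2) (z, t) = s / 2"
    using mem False by (auto simp: vpoint_def a_def)
  then have "(dist (a, s / 2) (z, t))\<^sup>2 = (s / 2)\<^sup>2" by (simp only:)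
  then have "(cmod (a - z))\<^sup>2 + (s / 2 - t)\<^sup>2 = (s / 2)\<^sup>2"
    by (simp only: dist_Pair_square)
  then have "(cmod (a - z))\<^sup>2 + t\<^sup>2 = s * t"
    by (simp add: power2_eq_square algebra_simps)
  moreover have "fst v - snd v * z = snd v * (a - z)"
    using False by (simp add: a_def field_simps)
  ultimately have "horofunction v z t = (cmod (snd v))\<^sup>2 * s"
    using \<open>t > 0\<close> by (simp add: horofunction_def norm_mult power_mult_distrib flip: distrib_left)
  then show ?thesis using h False by (simp add: horosphere_size_def field_simps)
qed

text \<open>Multiplicativity of the quaternion norm for r + q t j and cnj e + c t j.\<close>

lemma lagrange_identity:
  "(cmod (cnj e * r - of_real (t\<^sup>2) * q * cnj c))\<^sup>2 + (cmod (c * r + q * e))\<^sup>2 * t\<^sup>2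
   = ((cmod e)\<^sup>2 + (cmod c)\<^sup>2 * t\<^sup>2) * ((cmod r)\<^sup>2 + (cmod q)\<^sup>2 * t\<^sup>2)"
  unfolding cmod_power2 by (simp add: power2_eq_square algebra_simps)

text \<open>At the image point the two squares in \<open>horofunction\<close> become the left-hand
  terms of \<open>lagrange_identity\<close>, scaled by (|det M| / n)^2. The identity splits off a
  factor n, and division by t' leaves |det M|.\<close>

lemma horofunction_moebius:
  fixes M :: "complex^2^2"
  defines "a \<equiv> M $ 1 $ 1" and "b \<equiv> M $ 1 $ 2" and "c \<equiv> M $ 2 $ 1" and "d \<equiv> M $ 2 $ 2"
  assumes det: "det M \<noteq> 0" and t: "t > 0"
  obtains z' t' where "moebius_action M (Some (z, t)) = Some (z', t')" "t' > 0"
    "horofunction (lin a b c d v) z' t' = cmod (det M) * horofunction v z t"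
proof -
  define e r where "e = c * z + d" and "r = fst v - snd v * z"
  define n where "n = (cmod e)\<^sup>2 + (cmod c)\<^sup>2 * t\<^sup>2"
  define z' where "z' = ((a * z + b) * cnj e + a * cnj c * of_real (t\<^sup>2)) / of_real n"
  define t' where "t' = cmod (det M) * t / n"
  have D: "det M = a * d - b * c" by (simp add: det_2 a_def b_def c_def d_def)
  have "e \<noteq> 0 \<or> c \<noteq> 0" using det by (auto simp: D e_def)
  then have n: "n > 0" using t by (auto simp: n_def add_pos_nonneg add_nonneg_pos)
  have act: "moebius_action M (Some (z, t)) = Some (z', t')"
    using n by (simp add: Let_def z'_def t'_def n_def e_def a_def b_def c_def d_def)
  have t': "t' > 0" using n t det by (simp add: t'_def)
  have cn: "complex_of_real n = e * cnj e + c * cnj c * of_real (t\<^sup>2)"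
    unfolding n_def by (simp only: of_real_add of_real_mult complex_norm_square)
  let ?w = "lin a b c d v"
  have "(fst ?w - snd ?w * z') * of_real n = fst ?w * of_real n - snd ?w * (z' * of_real n)"
    by (simp add: algebra_simps)
  also have "z' * of_real n = (a * z + b) * cnj e + a * cnj c * of_real (t\<^sup>2)"
    using n by (simp add: z'_def)
  also have "fst ?w * of_real n - snd ?w * ((a * z + b) * cnj e + a * cnj c * of_real (t\<^sup>2))
      = det M * (cnj e * r - of_real (t\<^sup>2) * snd v * cnj c)"
    unfolding cn D lin_def r_def fst_conv snd_conv e_def by (simp add: algebra_simps)
  finally have "fst ?w - snd ?w * z' = det M * (cnj e * r - of_real (t\<^sup>2) * snd v * cnj c) / of_real n"
    using n by (simp add: field_simps)
  then have 1: "cmod (fst ?w - snd ?w * z') = cmod (det M) * cmod (cnj e * r - of_real (t\<^sup>2) * snd v * cnj c) / n"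
    using n by (simp add: norm_divide norm_mult)
  have 2: "snd ?w = c * r + snd v * e" by (simp add: lin_def r_def e_def algebra_simps)
  have "(cmod (fst ?w - snd ?w * z'))\<^sup>2 + (cmod (snd ?w))\<^sup>2 * t'\<^sup>2
      = (cmod (det M) / n)\<^sup>2 * ((cmod (cnj e * r - of_real (t\<^sup>2) * snd v * cnj c))\<^sup>2
          + (cmod (c * r + snd v * e))\<^sup>2 * t\<^sup>2)"
    unfolding 1 unfolding 2 t'_def by (simp add: power_mult_distrib power_divide algebra_simps)
  also have "\<dots> = (cmod (det M) / n)\<^sup>2 * (n * ((cmod r)\<^sup>2 + (cmod (snd v))\<^sup>2 * t\<^sup>2))"
    unfolding lagrange_identity n_def ..
  finally have "horofunction ?w z' t'
      = (cmod (det M) / n)\<^sup>2 * (n * ((cmod r)\<^sup>2 + (cmod (snd v))\<^sup>2 * t\<^sup>2)) / t'"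
    unfolding horofunction_def by (rule arg_cong)
  also have "\<dots> = cmod (det M) * horofunction v z t"
    using n t det by (simp add: horofunction_def t'_def r_def power2_eq_square field_simps)
  finally show thesis using act t' that by blast
qed

lemma moebius_vpoint:
  assumes "det M \<noteq> 0" "fst v \<noteq> 0 \<or> snd v \<noteq> 0"
  shows "moebius_action M (vpoint v) = vpoint (lin (M $ 1 $ 1) (M $ 1 $ 2) (M $ 2 $ 1) (M $ 2 $ 2) v)"
proof (cases "snd v = 0")
  case True
  then show ?thesis using assms by (simp add: vpoint_def lin_def)
next
  case False
  define z where "z = fst v / snd v"
  have v: "fst v = z * snd v" using False by (simp add: z_def)
  define e where "e = M $ 2 $ 1 * z + M $ 2 $ 2"
  \<comment> \<open>At e = 0, where the image is infinity, both sides are 0 because division by zero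
    yields 0.\<close>
  have "(M $ 1 $ 1 * z + M $ 1 $ 2) * cnj e / of_real ((cmod e)\<^sup>2) = (M $ 1 $ 1 * z + M $ 1 $ 2) / e"
    unfolding complex_norm_square by (cases "e = 0") auto
  moreover have "M $ 2 $ 1 * fst v + M $ 2 $ 2 * snd v = e * snd v"
    "M $ 1 $ 1 * fst v + M $ 1 $ 2 * snd v = (M $ 1 $ 1 * z + M $ 1 $ 2) * snd v"
    by (simp_all add: v e_def algebra_simps)
  ultimately show ?thesis
    using False by (simp add: vpoint_def lin_def Let_def flip: z_def e_def)
qed

text \<open>Supplies one point of the base horosphere on the level set of value 1: the top of the
  ball of diameter 1 at a finite vertex, or the point over 0 of the plane at height 1.\<close>

lemma base_vector:
  assumes "V \<in> base_tetrahedron"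
  obtains v w z where "V = vpoint v" "v \<in> eisenstein_vectors" "w \<in> eisenstein_vectors"
    "cmod (det2 v w) = 1" "horofunction v z 1 = 1" "(z, 1) \<in> horosphere V 1"
proof (cases "V = None")
  case True
  show thesis
    by (rule that[of "(1, 0)" "(0, 1)" 0])
       (simp_all add: True vpoint_def det2_def horofunction_def eisenstein_closed)
next
  case False
  then obtain a where a: "V = Some (a, 0)" "a \<in> eisenstein_integers"
    using assms by (auto simp: base_tetrahedron_def eisenstein_closed)
  show thesis
    by (rule that[of "(a, 1)" "(1, 0)" a])
       (simp_all add: a vpoint_def det2_def horofunction_def eisenstein_closed dist_Pair_Pair dist_norm)
qed

text \<open>One point of the base horosphere is carried along by \<open>M\<close>; its value 1
  survives because \<open>det M\<close> has modulus 1. The image vector and \<open>v\<close> have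
  coordinates of equal moduli, and \<open>horosphere_size\<close> sees only these.\<close>

lemma standard_horosphere_size:
  assumes std: "standard_horosphere (vpoint v) s" and v: "primitive v"
  shows "s = horosphere_size v"
proof -
  obtain M V where M: "M \<in> GL2_eisenstein" and V: "V \<in> base_tetrahedron"
    and P: "moebius_action M V = vpoint v"
    and img: "moebius_action M ` Some ` horosphere V 1 = Some ` horosphere (vpoint v) s"
    using std by (auto simp: standard_horosphere_def)
  obtain x y z where x: "V = vpoint x" "x \<in> eisenstein_vectors" "y \<in> eisenstein_vectors"
    "cmod (det2 x y) = 1" "horofunction x z 1 = 1" "(z, 1) \<in> horosphere V 1"
    using base_vector[OF V] by metis
  define a b c d where "a = M $ 1 $ 1" and "b = M $ 1 $ 2" and "c = M $ 2 $ 1" and "d = M $ 2 $ 2"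
  note abcd = a_def b_def c_def d_def
  have entries: "a \<in> eisenstein_integers" "b \<in> eisenstein_integers" "c \<in> eisenstein_integers"
    "d \<in> eisenstein_integers"
    using M by (auto simp: GL2_eisenstein_def abcd)
  have D: "det M = a * d - b * c" by (simp add: det_2 abcd)
  obtain u where u: "u \<in> eisenstein_integers" "det M * u = 1"
    using M by (auto simp: GL2_eisenstein_def)
  have nz: "det M \<noteq> 0" "u \<noteq> 0" using u by auto
  \<comment> \<open>\<open>det M\<close> and its inverse \<open>u\<close> are nonzero Eisenstein
    integers with product 1, so neither modulus can exceed 1.\<close>
  have "cmod (det M) \<ge> 1" "cmod u \<ge> 1"
    using nz u entries by (auto simp: D intro!: eisenstein_cmod_ge_1 eisenstein_closed)
  moreover have "cmod (det M) * cmod u = 1" using u by (metis norm_mult norm_one)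
  ultimately have cdet: "cmod (det M) = 1"
    by (smt (verit) mult_left_mono mult_cancel_left2)
  let ?w = "lin a b c d x"
  have lin: "lin a b c d u' \<in> eisenstein_vectors" if "u' \<in> eisenstein_vectors" for u'
    using that entries by (cases u') (auto simp: lin_def intro!: eisenstein_closed)
  \<comment> \<open>The image of the complement \<open>y\<close> of \<open>x\<close> complements the
    image of \<open>x\<close>.\<close>
  have w: "primitive ?w"
    unfolding primitive_def
    by (intro conjI bexI[of _ "lin a b c d y"] lin x)
       (use cdet x in \<open>simp add: det2_lin norm_mult D\<close>)
  have "fst x \<noteq> 0 \<or> snd x \<noteq> 0" using x(4) by (auto simp: det2_def)
  then have wv: "vpoint ?w = vpoint v"
    using moebius_vpoint[of M x] nz P x(1) by (simp add: abcd)
  obtain z' t' where zt: "moebius_action M (Some (z, 1)) = Some (z', t')" "t' > 0"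
    "horofunction ?w z' t' = cmod (det M) * horofunction x z 1"
    using horofunction_moebius[of M 1 z x] nz unfolding abcd by auto
  have "moebius_action M (Some (z, 1)) \<in> Some ` horosphere (vpoint v) s"
    unfolding img[symmetric] using x(6) by blast
  then have "(z', t') \<in> horosphere (vpoint ?w) s" unfolding zt(1) wv by blast
  then have "s = horosphere_size ?w"
    using zt cdet x primitive_nonzero[OF w] by (intro horofunction_size) auto
  then show ?thesis
    using primitive_unique[OF w v wv] by (metis (no_types) horosphere_size_def norm_eq_zero)
qed

section \<open>Lambda lengths\<close>

lemma arcosh_eq_abs_ln:
  assumes "k > 0"
  shows "arcosh ((k + 1 / k) / 2) = \<bar>ln (k :: real)\<bar>"
proof -
  have "cosh \<bar>ln k\<bar> = (k + 1 / k) / 2"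
    using cosh_ln_real[OF assms] by (cases "ln k < 0") (simp_all only: abs_if if_True if_False
        cosh_minus inverse_eq_divide)
  then show ?thesis using arcosh_cosh_real[of "\<bar>ln k\<bar>"] by (simp only: abs_ge_zero)
qed

text \<open>The cosh condition makes the distance |ln k|, and disjointness of the horoballs decides
  the sign of ln k, with tangency at k = 1.\<close>

lemma exp_signed_distanceI:
  assumes p: "geodesic P Q \<inter> horosphere P s = {p}" and q: "geodesic P Q \<inter> horosphere Q r = {q}"
    and disj: "horoball P s \<inter> horoball Q r = {} \<longleftrightarrow> k \<ge> 1" and k: "k > 0"
    and cosh: "1 + (dist p q)\<^sup>2 / (2 * snd p * snd q) = (k + 1 / k) / 2"
  shows "exp (signed_distance P s Q r) = k"
proof -
  have [simp]: "(THE x. x \<in> geodesic P Q \<inter> horosphere P s) = p" unfolding p by simp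
  have [simp]: "(THE x. x \<in> geodesic P Q \<inter> horosphere Q r) = q" unfolding q by simp
  have dist: "hyp_dist p q = \<bar>ln k\<bar>" unfolding hyp_dist_def cosh by (rule arcosh_eq_abs_ln[OF k])
  have "signed_distance P s Q r = (if k \<ge> 1 then hyp_dist p q else - hyp_dist p q)"
    by (simp add: signed_distance_def Let_def disj del: Int_iff)
  also have "\<dots> = ln k" using k by (simp add: dist abs_if)
  finally have "signed_distance P s Q r = ln k" .
  then show ?thesis using k by simp
qed

section \<open>A horosphere at infinity against one at a finite point\<close>

lemma dist_vertical: "dist (a, x) (a, y) = \<bar>x - (y :: real)\<bar>"
  by (simp add: dist_Pair_Pair dist_real_def)

lemma vertical_horosphere:
  assumes "r > 0"
  shows "{(z, t). t > 0 \<and> z = a} \<inter> horosphere (Some (a, 0)) r = {(a, r)}"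
  using assms by (auto simp: dist_Pair_Pair dist_real_def abs_if split: if_splits)

lemma horoball_infinity_disjoint:
  assumes "r > 0" "s > 0"
  shows "horoball None s \<inter> horoball (Some (a, 0)) r = {} \<longleftrightarrow> r \<le> s"
proof
  assume disj: "horoball None s \<inter> horoball (Some (a, 0)) r = {}"
  show "r \<le> s"
  proof (rule ccontr)
    assume "\<not> r \<le> s"
    \<comment> \<open>Halfway between the plane at height s and the top of the ball at height
      r.\<close>
    then have "(a, (r + s) / 2) \<in> horoball None s \<inter> horoball (Some (a, 0)) r"
      using assms by (simp add: dist_vertical abs_if field_simps)
    then show False using disj by blast
  qed
next
  assume "r \<le> s"
  have False if "(z, t) \<in> horoball None s \<inter> horoball (Some (a, 0)) r" for z t
  proof -
    have "dist (r / 2) t \<le> dist (a, r / 2) (z, t)" by (metis dist_snd_le snd_conv)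
    then show False using that \<open>r \<le> s\<close> by (auto simp: dist_real_def)
  qed
  then show "horoball None s \<inter> horoball (Some (a, 0)) r = {}"
    by (intro equals0I) (metis surj_pair)
qed

lemma exp_signed_distance_infinity:
  assumes s: "s > 0" and r: "r > 0"
  shows "exp (signed_distance None s (Some (a, 0)) r) = s / r"
    and "exp (signed_distance (Some (a, 0)) r None s) = s / r"
proof -
  have sph: "geodesic None (Some (a, 0)) \<inter> horosphere None s = {(a, s)}" using s by auto
  have cosh: "1 + (dist (a, s) (a, r))\<^sup>2 / (2 * s * r) = (s / r + 1 / (s / r)) / 2"
    using s r by (simp add: dist_vertical field_simps power2_eq_square)
  show "exp (signed_distance None s (Some (a, 0)) r) = s / r"
    by (rule exp_signed_distanceI[of _ _ _ "(a, s)" _ "(a, r)"])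
       (use s r cosh sph vertical_horosphere[OF r, of a] horoball_infinity_disjoint[OF r s, of a]
        in \<open>simp_all del: horosphere.simps horoball.simps\<close>)
  show "exp (signed_distance (Some (a, 0)) r None s) = s / r"
    by (rule exp_signed_distanceI[of _ _ _ "(a, r)" _ "(a, s)"])
       (use s r cosh sph vertical_horosphere[OF r, of a] horoball_infinity_disjoint[OF r s, of a]
        in \<open>simp_all del: horosphere.simps horoball.simps add: Int_commute dist_commute mult.commute mult.left_commute\<close>)
qed

section \<open>Two horospheres at finite points\<close>

lemma balls_disjoint_iff:
  fixes x y :: "'a::real_normed_vector"
  assumes "r > 0" "s > 0"
  shows "ball x r \<inter> ball y s = {} \<longleftrightarrow> r + s \<le> dist x y"
proof
  assume disj: "ball x r \<inter> ball y s = {}"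
  show "r + s \<le> dist x y"
  proof (rule ccontr)
    assume less: "\<not> r + s \<le> dist x y"
    \<comment> \<open>The point dividing the segment of centres in the ratio r : s.\<close>
    let ?m = "x + (r / (r + s)) *\<^sub>R (y - x)"
    have "dist x ?m = (r / (r + s)) * dist x y"
      using assms by (simp add: dist_norm norm_minus_commute)
    moreover have "y - ?m = (s / (r + s)) *\<^sub>R (y - x)"
    proof -
      have "s / (r + s) = 1 - r / (r + s)" using assms by (simp add: field_simps)
      then show ?thesis by (simp only: scaleR_left_diff_distrib scaleR_one) simp
    qed
    then have "dist y ?m = (s / (r + s)) * dist x y"
      using assms by (simp add: dist_norm norm_minus_commute)
    moreover have "(r / (r + s)) * dist x y < r" "(s / (r + s)) * dist x y < s"
    proof -
      have "dist x y / (r + s) < 1" using assms less by simp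
      from mult_strict_left_mono[OF this assms(1)] mult_strict_left_mono[OF this assms(2)]
      show "(r / (r + s)) * dist x y < r" "(s / (r + s)) * dist x y < s" by simp_all
    qed
    ultimately have "?m \<in> ball x r \<inter> ball y s" by simp
    then show False using disj by blast
  qed
qed (rule disjoint_ballI)

text \<open>The squared distance of the Euclidean centres is |a - b|^2 + (s/2 - r/2)^2, and (s/2 +
  r/2)^2 - (s/2 - r/2)^2 = s r.\<close>

lemma horoballs_disjoint:
  assumes s: "s > 0" and r: "r > 0"
  shows "horoball (Some (a, 0)) s \<inter> horoball (Some (b, 0)) r = {} \<longleftrightarrow> (dist a b)\<^sup>2 / (s * r) \<ge> 1"
proof -
  have "horoball (Some (a, 0)) s \<inter> horoball (Some (b, 0)) r = {}
      \<longleftrightarrow> s / 2 + r / 2 \<le> dist (a, s / 2) (b, r / 2)"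
    using balls_disjoint_iff[of "s / 2" "r / 2" "(a, s / 2)" "(b, r / 2)"] s r by simp
  also have "\<dots> \<longleftrightarrow> (s / 2 + r / 2)\<^sup>2 \<le> (dist (a, s / 2) (b, r / 2))\<^sup>2"
    using s r by (simp flip: abs_le_square_iff)
  also have "\<dots> \<longleftrightarrow> s * r \<le> (dist a b)\<^sup>2"
  proof -
    have "(dist (a, s / 2) (b, r / 2))\<^sup>2 = (dist a b)\<^sup>2 + (s / 2 - r / 2)\<^sup>2"
      by (simp add: dist_Pair_Pair dist_real_def)
    then show ?thesis
      unfolding \<open>(dist (a, s / 2) (b, r / 2))\<^sup>2 = _\<close> by (simp add: power2_eq_square algebra_simps)
  qed
  finally show ?thesis using s r by (simp add: field_simps)
qed

text \<open>
  Points of the geodesic from \<open>a\<close> to \<open>b\<close> are written as \<open>(a + u (b - a), t)\<close> with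
  \<open>t\<^sup>2 = u (1 - u) |b - a|\<^sup>2\<close>; the horosphere of size \<open>s\<close> at \<open>a\<close> then becomes \<open>u |b - a|\<^sup>2 = s t\<close>.
\<close>

lemma geodesic_horosphere:
  fixes a b :: complex
  assumes ab: "a \<noteq> b" and s: "s > 0"
  defines "L \<equiv> (dist a b)\<^sup>2"
  shows "geodesic (Some (a, 0)) (Some (b, 0)) \<inter> horosphere (Some (a, 0)) s
    = {(a + of_real (s\<^sup>2 / (s\<^sup>2 + L)) * (b - a), s * L / (s\<^sup>2 + L))}" (is "?G \<inter> ?H = {?p}")
proof -
  have L: "L > 0" using ab by (simp add: L_def)
  have sL: "s\<^sup>2 + L > 0" using s L by (simp add: add_pos_pos)
  have mem: "(a + of_real u * (b - a), t) \<in> ?G \<inter> ?H \<longleftrightarrow>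
      t > 0 \<and> t\<^sup>2 = u * (1 - u) * L \<and> u * L = s * t" if u: "0 \<le> u" "u \<le> 1" for u t
  proof -
    have "a + of_real u * (b - a) - midpoint a b = of_real (u - 1 / 2) * (b - a)"
      by (simp add: midpoint_def scaleR_conv_of_real field_simps)
    then have d1: "(dist (a + of_real u * (b - a), t) (midpoint a b, 0))\<^sup>2 = (u - 1 / 2)\<^sup>2 * L + t\<^sup>2"
      unfolding dist_Pair_square
      by (simp add: norm_mult power_mult_distrib L_def dist_norm norm_minus_commute del: of_real_diff)
    have d2: "(dist (a, s / 2) (a + of_real u * (b - a), t))\<^sup>2 = u\<^sup>2 * L + (s / 2 - t)\<^sup>2"
      unfolding dist_Pair_square
      by (simp add: norm_mult power_mult_distrib L_def dist_norm norm_minus_commute)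
    have sq: "x = y \<longleftrightarrow> x\<^sup>2 = y\<^sup>2" if "x \<ge> 0" "y \<ge> 0" for x y :: real
      using that by (simp add: power2_eq_iff_nonneg)
    have seg: "a + of_real u * (b - a) \<in> closed_segment a b"
      using u by (auto simp: in_segment scaleR_conv_of_real algebra_simps intro!: exI[of _ u])
    have "dist (a + of_real u * (b - a), t) (midpoint a b, 0) = dist a b / 2 \<longleftrightarrow>
        (u - 1 / 2)\<^sup>2 * L + t\<^sup>2 = L / 4"
      by (subst sq) (simp_all add: d1 L_def power_divide)
    also have "\<dots> \<longleftrightarrow> t\<^sup>2 = u * (1 - u) * L"
      by (auto simp: power2_eq_square algebra_simps)
    finally have 1: "(a + of_real u * (b - a), t) \<in> ?G \<longleftrightarrow> t > 0 \<and> t\<^sup>2 = u * (1 - u) * L"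
      using seg by simp
    have "dist (a, s / 2) (a + of_real u * (b - a), t) = s / 2 \<longleftrightarrow>
        u\<^sup>2 * L + (s / 2 - t)\<^sup>2 = (s / 2)\<^sup>2"
      using s by (subst sq) (simp_all add: d2)
    also have "\<dots> \<longleftrightarrow> u\<^sup>2 * L + t\<^sup>2 = s * t"
      by (auto simp: power2_eq_square algebra_simps)
    finally have 2: "(a + of_real u * (b - a), t) \<in> ?H \<longleftrightarrow> u\<^sup>2 * L + t\<^sup>2 = s * t" if "t > 0"
      using that by simp
    show ?thesis using 1 2 by (auto simp: power2_eq_square algebra_simps)
  qed
  have "?p \<in> ?G \<inter> ?H"
  proof (subst mem)
    show "0 \<le> s\<^sup>2 / (s\<^sup>2 + L)" "s\<^sup>2 / (s\<^sup>2 + L) \<le> 1" using L sL by simp_all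
    have "1 - s\<^sup>2 / (s\<^sup>2 + L) = L / (s\<^sup>2 + L)" using sL by (simp add: field_simps)
    then show "0 < s * L / (s\<^sup>2 + L) \<and>
        (s * L / (s\<^sup>2 + L))\<^sup>2 = s\<^sup>2 / (s\<^sup>2 + L) * (1 - s\<^sup>2 / (s\<^sup>2 + L)) * L \<and>
        s\<^sup>2 / (s\<^sup>2 + L) * L = s * (s * L / (s\<^sup>2 + L))"
      using s L sL by (simp add: power2_eq_square)
  qed
  moreover have "x = ?p" if x: "x \<in> ?G \<inter> ?H" for x
  proof -
    obtain z t where zt: "x = (z, t)" by (cases x)
    have "z \<in> closed_segment a b" using x by (simp add: zt)
    then obtain u where u: "0 \<le> u" "u \<le> 1" and z: "z = a + of_real u * (b - a)"
      by (auto simp: in_segment scaleR_conv_of_real algebra_simps)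
    have t: "t > 0" "t\<^sup>2 = u * (1 - u) * L" "u * L = s * t"
      using x unfolding zt z mem[OF u] by simp_all
    have u': "u > 0" using t(1,3) s u(1) by (cases "u = 0") auto
    \<comment> \<open>Squaring \<open>u * L = s * t\<close> and inserting t^2 eliminates t;
      cancelling the positive factor u L leaves a linear equation for u.\<close>
    have "(u * L) * (s\<^sup>2 * (1 - u)) = s\<^sup>2 * t\<^sup>2"
      by (simp add: t(2))
    also have "\<dots> = (u * L) * (u * L)" unfolding t(3) by (simp add: power2_eq_square)
    finally have "(u * L) * (s\<^sup>2 * (1 - u)) = (u * L) * (u * L)" .
    then have "s\<^sup>2 * (1 - u) = u * L" using u' L by simp
    then have u_eq: "u = s\<^sup>2 / (s\<^sup>2 + L)" using sL by (simp add: field_simps)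
    have "t = u * L / s" using t(3) s by (simp add: field_simps)
    also have "\<dots> = s * L / (s\<^sup>2 + L)" unfolding u_eq using s by (simp add: power2_eq_square)
    finally show ?thesis unfolding zt z u_eq by simp
  qed
  ultimately show ?thesis by blast
qed

lemma geodesic_commute: "geodesic (Some (a, 0)) (Some (b, 0)) = geodesic (Some (b, 0)) (Some (a, 0))"
  by (simp add: closed_segment_commute midpoint_sym dist_commute)

lemma exp_signed_distance_finite:
  assumes ab: "a \<noteq> b" and s: "s > 0" and r: "r > 0"
  shows "exp (signed_distance (Some (a, 0)) s (Some (b, 0)) r) = (dist a b)\<^sup>2 / (s * r)"
proof -
  define L where "L = (dist a b)\<^sup>2"
  have L: "L > 0" using ab by (simp add: L_def)
  define A B where "A = s\<^sup>2 + L" and "B = r\<^sup>2 + L"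
  have AB: "A > 0" "B > 0" using s r L by (simp_all add: A_def B_def add_pos_pos)
  \<comment> \<open>The points given by \<open>geodesic_horosphere\<close>, the second with the
    roles of a and b exchanged.\<close>
  define p q where "p = (a + of_real (s\<^sup>2 / A) * (b - a), s * L / A)"
    and "q = (b + of_real (r\<^sup>2 / B) * (a - b), r * L / B)"
  have "(a + of_real u * (b - a)) - (b + of_real w * (a - b)) = of_real (u + w - 1) * (b - a)" for u w
    by (simp add: algebra_simps)
  then have "fst p - fst q = of_real (s\<^sup>2 / A + r\<^sup>2 / B - 1) * (b - a)"
    by (simp only: p_def q_def fst_conv)
  moreover have "(dist p q)\<^sup>2 = (cmod (fst p - fst q))\<^sup>2 + (snd p - snd q)\<^sup>2"
    by (simp add: dist_prod_def dist_norm)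
  ultimately have "(dist p q)\<^sup>2 = (s\<^sup>2 / A + r\<^sup>2 / B - 1)\<^sup>2 * L + (s * L / A - r * L / B)\<^sup>2"
    by (simp add: p_def q_def norm_mult power_mult_distrib L_def dist_norm norm_minus_commute
        del: of_real_add of_real_diff)
  also have "\<dots> = ((s\<^sup>2 * B + r\<^sup>2 * A - A * B)\<^sup>2 * L + (s * L * B - r * L * A)\<^sup>2) / (A * B)\<^sup>2"
    using AB by (simp add: field_simps power2_eq_square)
  \<comment> \<open>Both squares contain (s r - L)^2; besides L, the cofactor is (s r + L)^2 + L (s
    - r)^2 = A B.\<close>
  also have "(s\<^sup>2 * B + r\<^sup>2 * A - A * B)\<^sup>2 * L + (s * L * B - r * L * A)\<^sup>2 = A * B * (L * (s * r - L)\<^sup>2)"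
    unfolding A_def B_def by algebra
  finally have dist: "(dist p q)\<^sup>2 = L * (s * r - L)\<^sup>2 / (A * B)"
    using AB by (simp add: power2_eq_square)
  show ?thesis unfolding L_def[symmetric]
  proof (rule exp_signed_distanceI)
    show "geodesic (Some (a, 0)) (Some (b, 0)) \<inter> horosphere (Some (a, 0)) s = {p}"
      using geodesic_horosphere[OF ab s] unfolding p_def A_def L_def .
    show "geodesic (Some (a, 0)) (Some (b, 0)) \<inter> horosphere (Some (b, 0)) r = {q}"
      using geodesic_horosphere[OF ab[symmetric] r]
      unfolding q_def B_def L_def dist_commute[of b] geodesic_commute[of b] .
    show "horoball (Some (a, 0)) s \<inter> horoball (Some (b, 0)) r = {} \<longleftrightarrow> 1 \<le> L / (s * r)"
      unfolding L_def by (rule horoballs_disjoint[OF s r])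
    show "0 < L / (s * r)" using L s r by simp
    show "1 + (dist p q)\<^sup>2 / (2 * snd p * snd q) = (L / (s * r) + 1 / (L / (s * r))) / 2"
      unfolding dist using AB L s r
      by (simp add: p_def q_def divide_simps power2_eq_square) (simp add: algebra_simps)
  qed
qed

text \<open>The constant \<open>c\<close> and the vector \<open>x\<close> depend only on
  \<open>P\<close> and its horosphere, so they serve all four vertices at once; the free size at
  \<open>P\<close> is absorbed into \<open>c\<close>.\<close>

lemma lambda_length_square:
  assumes "P \<in> extended_eisenstein_field" "hs P > 0"
  obtains c x where "\<And>v. fst v \<noteq> 0 \<or> snd v \<noteq> 0 \<Longrightarrow> vpoint v \<noteq> P \<Longrightarrow>
    hs (vpoint v) = horosphere_size v \<Longrightarrow>
    (lambda_length hs P (vpoint v))\<^sup>2 = c * (cmod (det2 x v))\<^sup>2"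
proof -
  have sq: "(lambda_length hs P Q)\<^sup>2 = exp (signed_distance P (hs P) Q (hs Q))" for Q
    by (simp add: lambda_length_def flip: exp_double)
  show thesis
  proof (cases P)
    case None
    show thesis
    proof (rule that[of "hs P" "(1, 0)"])
      fix v assume v: "fst v \<noteq> 0 \<or> snd v \<noteq> 0" "vpoint v \<noteq> P" "hs (vpoint v) = horosphere_size v"
      then have "snd v \<noteq> 0" using None by (auto simp: vpoint_def)
      then show "(lambda_length hs P (vpoint v))\<^sup>2 = hs P * (cmod (det2 (1, 0) v))\<^sup>2"
        unfolding sq v(3) using assms None
        by (simp add: vpoint_def horosphere_size_def exp_signed_distance_infinity det2_def)
    qed
  next
    case (Some y)
    then obtain z where P: "P = Some (z, 0)"
      using assms(1) by (auto simp: extended_eisenstein_field_def)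
    show thesis
    proof (rule that[of "1 / hs P" "(z, 1)"])
      fix v assume v: "fst v \<noteq> 0 \<or> snd v \<noteq> 0" "vpoint v \<noteq> P" "hs (vpoint v) = horosphere_size v"
      show "(lambda_length hs P (vpoint v))\<^sup>2 = 1 / hs P * (cmod (det2 (z, 1) v))\<^sup>2"
      proof (cases "snd v = 0")
        case True
        then show ?thesis
          unfolding sq v(3) using assms P v(1)
          by (simp add: vpoint_def horosphere_size_def exp_signed_distance_infinity det2_def)
      next
        case False
        have "z \<noteq> fst v / snd v" using v(2) False by (auto simp: P vpoint_def)
        then have "(lambda_length hs P (vpoint v))\<^sup>2
            = (dist z (fst v / snd v))\<^sup>2 / (hs P * (1 / (cmod (snd v))\<^sup>2))"
          unfolding sq v(3) using assms P False
          by (simp add: vpoint_def horosphere_size_def exp_signed_distance_finite)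
        moreover have "det2 (z, 1) v = (z - fst v / snd v) * snd v"
          using False by (simp add: det2_def field_simps)
        then have "cmod (det2 (z, 1) v) = dist z (fst v / snd v) * cmod (snd v)"
          by (simp add: dist_norm norm_mult)
        ultimately show ?thesis by (simp add: power_mult_distrib)
      qed
    qed
  qed
qed

section \<open>The relation\<close>

text \<open>The hypotheses make 0, b, \<omega> b an equilateral triangle (degenerate if b = 0). This
  is the classical relation between its side |b| and the distances from a to its vertices.\<close>

lemma unit_rhombus_relation:
  fixes a b \<omega> :: complex
  assumes "cmod \<omega> = 1" "cmod (1 - \<omega>) = 1"
  defines "f \<equiv> (cmod b)\<^sup>2" and "g \<equiv> (cmod a)\<^sup>2" and "h \<equiv> (cmod (a - b))\<^sup>2"
    and "k \<equiv> (cmod (a - \<omega> * b))\<^sup>2"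
  shows "f\<^sup>2 + g\<^sup>2 + h\<^sup>2 + k\<^sup>2 = f * g + f * h + f * k + g * h + g * k + h * k"
proof -
  have 1: "(Re \<omega>)\<^sup>2 + (Im \<omega>)\<^sup>2 = 1" using assms(1) by (simp flip: cmod_power2)
  have "(1 - Re \<omega>)\<^sup>2 + (Im \<omega>)\<^sup>2 = 1"
    using assms(2) cmod_power2[of "1 - \<omega>"] by simp
  with 1 have re: "Re \<omega> = 1 / 2" by (simp add: power2_eq_square algebra_simps)
  \<comment> \<open>y is a square root of 3 of either sign; working with y^2 = 3 covers both
    orientations of the triangle.\<close>
  define y where "y = 2 * Im \<omega>"
  have y: "y * y = 3" using 1 by (simp add: re y_def power2_eq_square)
  have im: "Im \<omega> = y / 2" by (simp add: y_def)
  \<comment> \<open>Real and imaginary part of a cnj b, whence m^2 + n^2 = |a|^2 |b|^2.\<close>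
  define m n where "m = Re a * Re b + Im a * Im b" and "n = Im a * Re b - Re a * Im b"
  have mn: "m * m + n * n = f * g"
    unfolding m_def n_def f_def g_def cmod_power2 by (simp add: power2_eq_square algebra_simps)
  have h: "h = f + g - 2 * m"
    unfolding m_def h_def f_def g_def cmod_power2 by (simp add: power2_eq_square algebra_simps)
  have "(cmod (\<omega> * b))\<^sup>2 = f" using assms(1) by (simp add: norm_mult f_def)
  moreover have "k = g + (cmod (\<omega> * b))\<^sup>2 - 2 * (Re a * Re (\<omega> * b) + Im a * Im (\<omega> * b))"
    unfolding k_def g_def cmod_power2 by (simp add: power2_eq_square algebra_simps)
  ultimately have k: "k = f + g - m - y * n"
    unfolding m_def n_def by (simp add: re im algebra_simps)
  show ?thesis unfolding h k using mn y by algebra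
qed

lemma det2_pluecker: "det2 u v * det2 w x - det2 u w * det2 v x + det2 u x * det2 v w = 0"
  by (simp add: det2_def algebra_simps)

lemma unimodular_relation:
  fixes v1 v2 v3 v4 x :: "complex \<times> complex"
  assumes "cmod (det2 v1 v2) = 1" "cmod (det2 v1 v3) = 1" "cmod (det2 v1 v4) = 1"
    "cmod (det2 v2 v3) = 1" "cmod (det2 v2 v4) = 1" "cmod (det2 v3 v4) = 1"
  defines "f \<equiv> \<lambda>v. (cmod (det2 x v))\<^sup>2"
  shows "(f v1)\<^sup>2 + (f v2)\<^sup>2 + (f v3)\<^sup>2 + (f v4)\<^sup>2
    = f v1 * f v2 + f v1 * f v3 + f v1 * f v4 + f v2 * f v3 + f v2 * f v4 + f v3 * f v4"
proof -
  \<comment> \<open>Multiplying by determinants of modulus 1 does not change moduli; these factors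
    are chosen so that a - b and a - \<omega> b become such multiples of det (x, v3) and det (x,
    v4).\<close>
  define a b where "a = det2 x v2 * det2 v1 v3" and "b = det2 x v1 * det2 v2 v3"
  define \<omega> where "\<omega> = det2 v2 v4 * det2 v1 v3 / (det2 v2 v3 * det2 v1 v4)"
  have nz: "det2 v2 v3 \<noteq> 0" "det2 v1 v4 \<noteq> 0" "det2 v1 v3 \<noteq> 0" using assms by auto
  have "1 - \<omega> = - (det2 v1 v2 * det2 v3 v4) / (det2 v2 v3 * det2 v1 v4)"
    using nz det2_pluecker[of v1 v2 v3 v4] unfolding \<omega>_def by (simp add: field_simps) algebra
  then have "cmod (1 - \<omega>) = 1" by (simp add: norm_divide norm_mult assms)
  moreover have "cmod \<omega> = 1" by (simp add: \<omega>_def norm_divide norm_mult assms)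
  moreover have "f v1 = (cmod b)\<^sup>2" "f v2 = (cmod a)\<^sup>2"
    by (simp_all add: f_def a_def b_def norm_mult assms)
  moreover have "a - b = det2 x v3 * det2 v1 v2"
    using det2_pluecker[of x v1 v2 v3] unfolding a_def b_def by algebra
  then have "f v3 = (cmod (a - b))\<^sup>2" by (simp add: f_def norm_mult assms)
  moreover have "a - \<omega> * b = det2 x v4 * det2 v1 v2 * det2 v1 v3 / det2 v1 v4"
    using det2_pluecker[of x v1 v2 v4] nz unfolding a_def b_def \<omega>_def
    by (simp add: field_simps) algebra
  then have "f v4 = (cmod (a - \<omega> * b))\<^sup>2" by (simp add: f_def norm_mult norm_divide assms)
  ultimately show ?thesis using unit_rhombus_relation[of \<omega> b a] by simp
qed

theorem theorem4p7:
  fixes A :: "nat \<Rightarrow> point" and X :: point and hs :: "point \<Rightarrow> real" and lam :: "nat \<Rightarrow> real"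
  assumes tetrahedron: "A ` {1..4} \<in> fundamental_tetrahedra"
    and X: "X \<in> extended_eisenstein_field" "X \<notin> A ` {1..4}"
    and horospheres: "\<And>P. P \<in> extended_eisenstein_field \<Longrightarrow> hs P > 0"
    and standard: "\<And>i. i \<in> {1..4} \<Longrightarrow> standard_horosphere (A i) (hs (A i))"
    and lambda: "\<And>i. i \<in> {1..4} \<Longrightarrow> lam i = lambda_length hs X (A i)"
  shows "(\<Sum>i=1..4. lam i ^ 4) = (\<Sum>i=1..4. \<Sum>j\<in>{i<..4}. (lam i)\<^sup>2 * (lam j)\<^sup>2)"
proof -
  obtain v :: "nat \<Rightarrow> complex \<times> complex" where A_eq: "A ` {1..4} = (\<lambda>i. vpoint (v i)) ` {1..4}"
    and v: "v ` {1..4} \<subseteq> eisenstein_vectors"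
    and dets: "\<And>i j. i \<in> {1..4} \<Longrightarrow> j \<in> {1..4} \<Longrightarrow> i \<noteq> j \<Longrightarrow> cmod (det2 (v i) (v j)) = 1"
    using fundamental_unimodular[OF tetrahedron] unfolding unimodular_tetrahedron_def
    by (elim exE conjE) (rule that, assumption+, simp)
  \<comment> \<open>Nonzero determinants separate the four points, so the vertex set has four
    elements and \<open>A\<close> must enumerate it injectively.\<close>
  have "inj_on (\<lambda>i. vpoint (v i)) {1..4}"
  proof (rule inj_onI, rule ccontr)
    fix i j assume "i \<in> {1..4::nat}" "j \<in> {1..4::nat}" "vpoint (v i) = vpoint (v j)" "i \<noteq> j"
    then show False using dets[of i j] vpoint_eq_imp_det2_0[of "v i" "v j"] by simp
  qed
  then have "card (A ` {1..4}) = card {1..4::nat}" unfolding A_eq by (rule card_image)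
  then have inj: "inj_on A {1..4}" by (intro eq_card_imp_inj_on) auto
  \<comment> \<open>The representatives may come in another order than \<open>A\<close>;
    \<open>\<pi>\<close> matches the two numberings.\<close>
  have "\<forall>i\<in>{1..4}. \<exists>j\<in>{1..4}. A i = vpoint (v j)" using A_eq by blast
  then obtain \<pi> where \<pi>: "\<And>i. i \<in> {1..4} \<Longrightarrow> \<pi> i \<in> {1..4}"
    "\<And>i. i \<in> {1..4} \<Longrightarrow> A i = vpoint (v (\<pi> i))" by metis
  define w where "w i = v (\<pi> i)" for i
  have det: "cmod (det2 (w i) (w j)) = 1" if "i \<in> {1..4}" "j \<in> {1..4}" "i \<noteq> j" for i j
  proof -
    have "A i \<noteq> A j" using inj that by (auto dest: inj_onD)
    then have "\<pi> i \<noteq> \<pi> j" using \<pi> that by metis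
    then show ?thesis unfolding w_def using \<pi> that by (intro dets) auto
  qed
  have wE: "w i \<in> eisenstein_vectors" if "i \<in> {1..4}" for i
    using v \<pi>(1)[OF that] unfolding w_def by blast
  \<comment> \<open>Any other vertex vector serves as the complement.\<close>
  have prim: "primitive (w i)" if "i \<in> {1..4}" for i
  proof -
    obtain j where "j \<in> {1..4::nat}" "i \<noteq> j"
      by (rule that[of "if i = 1 then 2 else 1"]) auto
    then show ?thesis unfolding primitive_def using that wE det by blast
  qed
  have A: "A i = vpoint (w i)" if "i \<in> {1..4}" for i using \<pi> that by (simp add: w_def)
  obtain c x where cx: "\<And>v. fst v \<noteq> 0 \<or> snd v \<noteq> 0 \<Longrightarrow> vpoint v \<noteq> X \<Longrightarrow>
      hs (vpoint v) = horosphere_size v \<Longrightarrow>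
      (lambda_length hs X (vpoint v))\<^sup>2 = c * (cmod (det2 x v))\<^sup>2"
    using lambda_length_square[of X hs, OF X(1) horospheres[OF X(1)]] by blast
  define f where "f i = (cmod (det2 x (w i)))\<^sup>2" for i
  have lam: "(lam i)\<^sup>2 = c * f i" if i: "i \<in> {1..4}" for i
    unfolding lambda[OF i] A[OF i] f_def
  proof (rule cx)
    show "vpoint (w i) \<noteq> X" unfolding A[OF i, symmetric] using X(2) i by blast
    show "hs (vpoint (w i)) = horosphere_size (w i)"
      using standard[OF i] prim[OF i] unfolding A[OF i] by (rule standard_horosphere_size)
  qed (rule primitive_nonzero[OF prim[OF i]])
  have lam4: "lam i ^ 4 = (c * f i)\<^sup>2" if "i \<in> {1..4}" for i
    unfolding lam[OF that, symmetric] by simp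
  have rel: "(f 1)\<^sup>2 + (f 2)\<^sup>2 + (f 3)\<^sup>2 + (f 4)\<^sup>2
      = f 1 * f 2 + f 1 * f 3 + f 1 * f 4 + f 2 * f 3 + f 2 * f 4 + f 3 * f 4"
    unfolding f_def by (rule unimodular_relation) (rule det; simp)+
  have tails: "{Suc 0<..4} = {2, 3, 4}" "{2<..4::nat} = {3, 4}" "{3<..4::nat} = {4}" by auto
  have "(\<Sum>i=1..4. lam i ^ 4) = (\<Sum>i=1..4. (c * f i)\<^sup>2)" by (intro sum.cong refl lam4)
  \<comment> \<open>Both sides are homogeneous of degree 2 in the squared lambda-lengths, so the
    common constant factors out.\<close>
  also have "\<dots> = c\<^sup>2 * ((f 1)\<^sup>2 + (f 2)\<^sup>2 + (f 3)\<^sup>2 + (f 4)\<^sup>2)"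
    unfolding atLeastAtMost_1_4 by (simp add: power_mult_distrib algebra_simps)
  also have "\<dots> = (\<Sum>i=1..4. \<Sum>j\<in>{i<..4}. (c * f i) * (c * f j))"
    unfolding rel atLeastAtMost_1_4 by (simp add: tails power2_eq_square algebra_simps)
  also have "\<dots> = (\<Sum>i=1..4. \<Sum>j\<in>{i<..4}. (lam i)\<^sup>2 * (lam j)\<^sup>2)"
    by (intro sum.cong refl) (simp add: lam)
  finally show ?thesis .
qed

end
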